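(* Let $k$ be a positive integer, let $c(n,k)$ be defined by $(1-k^2x)^{-1/k}=\sum_{n\ge 0}c(n,k)x^n$, and let $p$ be a prime not dividing $k$. Write $n=\sum_{m\ge0}a_mp^m$ in base $p$ (digits $0\le a_m\le p-1$, all but finitely many zero), and write the $p$-adic integer $1/k$ as $1/k=1+\sum_{m\ge 0}b_mp^m$ with digits $0\le b_m\le p-1$. Then $\nu_p(c(n,k))$ equals the number of indices $m\ge 0$ such that either (i) $a_m+b_m\ge p$, or (ii) there is $j\le m$ such that $a_{m-i}+b_{m-i}=p-1$ for all $0\le i\le j-1$ and $a_{m-j}+b_{m-j}\ge p$.
   Context: $\nu_p(N)$ denotes the exponent of the highest power of $p$ dividing the integer $N$. Since $p\nmid k$, $1/k-1$ is a $p$-adic integer and the $b_m$ are its $p$-adic digits. *)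

theory Defs
  imports Complex_Main "HOL-Computational_Algebra.Computational_Algebra"
begin

definition gen_binomial_fps :: "nat \<Rightarrow> rat fps" where
  "gen_binomial_fps k =
     fps_compose (fps_binomial (- 1 / of_nat k)) (- (fps_const (of_nat k ^ 2) * fps_X))"

text \<open>
  The coefficients of \<open>(1 - k\<^sup>2 x) powr (-1/k)\<close>, the binomial series \<open>(1 + y) powr (-1/k)\<close>
  with \<open>y = - k\<^sup>2 x\<close> substituted. They are in
  fact integers, which is not built into the type.
\<close>
definition c :: "nat \<Rightarrow> nat \<Rightarrow> rat" where
  "c n k = fps_nth (gen_binomial_fps k) n"

text \<open>
  \<open>padic_val p 0\<close> is a junk value (mathematically infinite); \<open>padic_abs\<close> treats 0 separately.
\<close>
definition padic_val :: "nat \<Rightarrow> rat \<Rightarrow> int" where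
  "padic_val p x =
     int (multiplicity (int p) (fst (quotient_of x))) -
     int (multiplicity (int p) (snd (quotient_of x)))"

definition padic_abs :: "nat \<Rightarrow> rat \<Rightarrow> real" where
  "padic_abs p x = (if x = 0 then 0 else real p powi (- padic_val p x))"

text \<open>
  Convergence of a series in the field of \<open>p\<close>-adic numbers, for rational terms and a rational
  sum. Both the partial sums and the limit then lie in the rationals, on which the
  \<open>p\<close>-adic metric is \<open>padic_abs p (x - y)\<close>, so the completion itself is not needed.
\<close>
definition padic_sums :: "nat \<Rightarrow> (nat \<Rightarrow> rat) \<Rightarrow> rat \<Rightarrow> bool" where
  "padic_sums p f s \<longleftrightarrow> (\<lambda>M. padic_abs p ((\<Sum>m<M. f m) - s)) \<longlonglongrightarrow> 0"

definition base_digits :: "nat \<Rightarrow> (nat \<Rightarrow> nat) \<Rightarrow> nat \<Rightarrow> bool" where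
  "base_digits p a n \<longleftrightarrow>
     (\<forall>m. a m \<le> p - 1) \<and> finite {m. a m \<noteq> 0} \<and> n = (\<Sum>m | a m \<noteq> 0. a m * p ^ m)"

definition padic_digits :: "nat \<Rightarrow> (nat \<Rightarrow> nat) \<Rightarrow> rat \<Rightarrow> bool" where
  "padic_digits p b x \<longleftrightarrow>
     (\<forall>m. b m \<le> p - 1) \<and> padic_sums p (\<lambda>m. of_nat (b m) * of_nat p ^ m) x"

definition carry_positions :: "nat \<Rightarrow> (nat \<Rightarrow> nat) \<Rightarrow> (nat \<Rightarrow> nat) \<Rightarrow> nat set" where
  "carry_positions p a b =
     {m. a m + b m \<ge> p \<or>
         (\<exists>j\<le>m. (\<forall>i<j. a (m - i) + b (m - i) = p - 1) \<and> a (m - j) + b (m - j) \<ge> p)}"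

end

(* Up to a power of k the coefficient c(n,k) is the product of the 1 + i k (i < n) divided by n!.
   If k (B + 1) = 1 modulo Q with 0 <= B < Q, exactly (n + B) div Q of these factors are divisible
   by Q, against n div Q of the factors of n!.  Summing over the powers Q of a prime not dividing k
   gives the valuation; primes dividing k are absorbed by the power of k, so c(n,k) is an integer.
   For Q = p^(m+1), the residue B is the truncation of the p-adic expansion of 1/k - 1, and
   (n + B) div Q exceeds n div Q, by one, exactly when adding n and B carries out of position m
   (as in Kummer's theorem). *)
theory Submission
  imports Defs "HOL-Number_Theory.Cong"
begin

section \<open>Counting factors divisible by prime powers\<close>

text \<open>Double counting: \<open>f i\<close> contributes 1 for each exponent \<open>M\<close>
  from 1 to its multiplicity, and the two sums are swapped. \<open>T\<close> is any common bound, so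
  that the range of \<open>M\<close> does not depend on \<open>i\<close>.\<close>

lemma multiplicity_prod_eq_sum_card:
  fixes f :: "'a \<Rightarrow> nat"
  assumes p: "prime p" and A: "finite A" and f: "\<And>i. i \<in> A \<Longrightarrow> f i > 0"
    and T: "\<And>i. i \<in> A \<Longrightarrow> multiplicity p (f i) \<le> T"
  shows "multiplicity p (\<Prod>i\<in>A. f i) = (\<Sum>M=1..T. card {i\<in>A. p ^ M dvd f i})"
proof -
  have one: "multiplicity p (f i) = (\<Sum>M=1..T. if p ^ M dvd f i then 1 else 0)" if "i \<in> A" for i
  proof -
    have "\<not> is_unit p" using p by auto
    then have "p ^ M dvd f i \<longleftrightarrow> M \<le> multiplicity p (f i)" for M
      using f[OF that] by (intro power_dvd_iff_le_multiplicity) auto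
    then have "(\<Sum>M=1..T. if p ^ M dvd f i then 1 else 0)
        = (\<Sum>M\<in>{1..T}. if M \<in> {1..multiplicity p (f i)} then 1 else (0::nat))"
      by (intro sum.cong) auto
    also have "\<dots> = card ({1..T} \<inter> {1..multiplicity p (f i)})"
      by (subst sum.If_cases) (simp_all only: finite_atLeastAtMost Collect_mem_eq sum.neutral_const
          add_0_right card_eq_sum)
    also have "{1..T} \<inter> {1..multiplicity p (f i)} = {1..multiplicity p (f i)}"
      using T[OF that] by auto
    finally show ?thesis by simp
  qed
  have "multiplicity p (\<Prod>i\<in>A. f i) = (\<Sum>i\<in>A. multiplicity p (f i))"
    using p A by (intro prime_elem_multiplicity_prod_distrib) (auto dest: f)
  also have "\<dots> = (\<Sum>i\<in>A. \<Sum>M=1..T. if p ^ M dvd f i then 1 else 0)"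
    using one by (intro sum.cong) auto
  also have "\<dots> = (\<Sum>M=1..T. \<Sum>i\<in>A. if p ^ M dvd f i then 1 else 0)"
    by (rule sum.swap)
  also have "\<dots> = (\<Sum>M=1..T. card {i\<in>A. p ^ M dvd f i})"
    using A by (intro sum.cong refl) (simp add: sum.If_cases Int_def)
  finally show ?thesis .
qed

text \<open>Induction on \<open>n\<close>: both sides grow by one exactly when
  \<open>n mod Q = r\<close>. The shift \<open>Q - 1 - r\<close> makes the quotient jump just after
  such an \<open>n\<close>.\<close>

lemma card_mod_eq:
  fixes Q r n :: nat
  assumes "r < Q"
  shows "card {i. i < n \<and> i mod Q = r} = (n + (Q - 1 - r)) div Q"
proof (induction n)
  case 0
  show ?case using assms by simp
next
  case (Suc n)
  define s where "s = Q - 1 - r"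
  have s: "s + r + 1 = Q" using assms by (simp add: s_def)
  have "card {i. i < Suc n \<and> i mod Q = r} =
      card {i. i < n \<and> i mod Q = r} + (if n mod Q = r then 1 else 0)"
  proof (cases "n mod Q = r")
    case True
    then have "{i. i < Suc n \<and> i mod Q = r} = insert n {i. i < n \<and> i mod Q = r}"
      by (auto simp: less_Suc_eq)
    then show ?thesis using True by simp
  next
    case False
    then have "{i. i < Suc n \<and> i mod Q = r} = {i. i < n \<and> i mod Q = r}"
      by (auto simp: less_Suc_eq)
    then show ?thesis using False by simp
  qed
  moreover have "(Suc n + s) div Q = (n + s) div Q + (if n mod Q = r then 1 else 0)"
  proof -
    have "Suc (n + s) mod Q = 0 \<longleftrightarrow> n mod Q = r"
    proof -
      have "[Suc (n + s) = 0] (mod Q) \<longleftrightarrow> [n + (s + 1) = r + (s + 1)] (mod Q)"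
        using s by (simp add: cong_def add.commute)
      also have "\<dots> \<longleftrightarrow> [n = r] (mod Q)"
        by (rule cong_add_rcancel_nat)
      finally show ?thesis using assms by (simp add: cong_def)
    qed
    then show ?thesis by (simp add: div_Suc)
  qed
  ultimately show ?case using Suc by (simp add: s_def)
qed

text \<open>Since \<open>B + 1\<close> inverts \<open>k\<close> modulo \<open>Q\<close>, the factor
  \<open>1 + i * k\<close> vanishes modulo \<open>Q\<close> exactly for \<open>i\<close> congruent
  to \<open>-(B + 1)\<close>, a single residue class, which \<open>card_mod_eq\<close>
  counts.\<close>

lemma card_dvd_linear:
  fixes Q k B n :: nat
  assumes B: "B < Q" and inv: "[k * (B + 1) = 1] (mod Q)"
  shows "card {i\<in>{..<n}. Q dvd 1 + i * k} = (n + B) div Q"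
proof -
  have "Q dvd 1 + i * k \<longleftrightarrow> i mod Q = Q - 1 - B" for i
  proof -
    have cop: "coprime (B + 1) Q"
      unfolding coprime_iff_invertible_nat using inv
      by (intro exI[of _ k]) (simp only: mult.commute One_nat_def)
    have "Q dvd 1 + i * k \<longleftrightarrow> [1 + i * k = 0] (mod Q)"
      by (simp add: cong_0_iff)
    also have "\<dots> \<longleftrightarrow> [(1 + i * k) * (B + 1) = 0 * (B + 1)] (mod Q)"
      by (rule cong_mult_rcancel_nat[OF cop, symmetric])
    also have "(1 + i * k) * (B + 1) = (B + 1) + i * (k * (B + 1))"
      by (simp add: algebra_simps)
    also have "[\<dots> = 0 * (B + 1)] (mod Q) \<longleftrightarrow> [(B + 1) + i * 1 = 0 * (B + 1)] (mod Q)"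
    proof -
      have "[(B + 1) + i * (k * (B + 1)) = (B + 1) + i * 1] (mod Q)"
        by (intro cong_add cong_mult cong_refl inv)
      then show ?thesis by (simp only: cong_def)
    qed
    \<comment> \<open>As \<open>B < Q\<close>, the new right-hand side is \<open>Q\<close>, hence 0
      modulo \<open>Q\<close>; in this form \<open>B + 1\<close> can be cancelled.\<close>
    also have "\<dots> \<longleftrightarrow> [i + (B + 1) = (Q - 1 - B) + (B + 1)] (mod Q)"
      using B by (simp add: cong_def add.commute)
    also have "\<dots> \<longleftrightarrow> [i = Q - 1 - B] (mod Q)"
      by (rule cong_add_rcancel_nat)
    finally show ?thesis using B by (simp add: cong_def)
  qed
  then show ?thesis using card_mod_eq[of "Q - 1 - B" Q n] B by simp
qed

lemma card_dvd_Suc: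
  fixes Q n :: nat
  assumes "Q > 0"
  shows "card {i\<in>{..<n}. Q dvd 1 + i} = n div Q"
  using card_dvd_linear[of 0 Q 1 n] assms by simp

section \<open>Factorials and integrality of the coefficients\<close>

text \<open>After the first term, the sum is the same one for \<open>n div q\<close>, so induction
  bounds the total by \<open>2 * (n div q)\<close>. This controls the primes dividing
  \<open>k\<close> in \<open>fact_dvd_power_mult_prod\<close>.\<close>

lemma sum_div_powers_le:
  fixes q n :: nat
  assumes "q \<ge> 2"
  shows "(\<Sum>M=1..T. n div q ^ M) \<le> n"
proof (induction T arbitrary: n)
  case (Suc T)
  have "(\<Sum>M=1..Suc T. n div q ^ M) = n div q + (\<Sum>M=2..Suc T. n div q ^ M)"
    by (subst sum.atLeast_Suc_atMost) (auto simp: numeral_2_eq_2)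
  also have "(\<Sum>M=2..Suc T. n div q ^ M) = (\<Sum>M=1..T. n div q ^ Suc M)"
    using sum.shift_bounds_cl_Suc_ivl[of "\<lambda>M. n div q ^ M" 1 T] by (simp add: numeral_2_eq_2)
  also have "\<dots> = (\<Sum>M=1..T. (n div q) div q ^ M)"
    by (simp add: div_mult2_eq)
  also have "n div q + \<dots> \<le> n div q + n div q" using Suc by simp
  also have "\<dots> \<le> q * (n div q)" using mult_le_mono1[OF assms, of "n div q"] by (simp only: mult_2)
  also have "\<dots> \<le> n" by simp
  finally show ?case .
qed simp

text \<open>Legendre's formula, cut off at a bound \<open>T\<close> for the multiplicities of the
  factors.\<close>

lemma multiplicity_fact_eq_sum_div:
  fixes p n :: nat
  assumes p: "prime p" and T: "\<And>i. i < n \<Longrightarrow> multiplicity p (1 + i) \<le> T"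
  shows "multiplicity p (fact n) = (\<Sum>M=1..T. n div p ^ M)"
proof -
  have "fact n = (\<Prod>i<n. 1 + i)"
    by (simp add: fact_prod_Suc atLeast0LessThan)
  then have "multiplicity p (fact n) = multiplicity p (\<Prod>i<n. 1 + i)" by simp
  also have "\<dots> = (\<Sum>M=1..T. card {i\<in>{..<n}. p ^ M dvd 1 + i})"
    using T by (intro multiplicity_prod_eq_sum_card p) auto
  also have "\<dots> = (\<Sum>M=1..T. n div p ^ M)"
    using card_dvd_Suc[of "p ^ _" n] prime_gt_0_nat[OF p] by simp
  finally show ?thesis .
qed

lemma exists_shifted_inverse:
  fixes Q k :: nat
  assumes "coprime k Q" "Q > 0"
  shows "\<exists>B<Q. [k * (B + 1) = 1] (mod Q)"
proof -
  obtain x where x: "[k * x = 1] (mod Q)"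
    using cong_solve_coprime_nat[OF assms(1)] by auto
  \<comment> \<open>This is \<open>x - 1\<close> modulo \<open>Q\<close>; adding
    \<open>Q - 1\<close> avoids truncated subtraction at \<open>x = 0\<close>.\<close>
  define B where "B = (x + (Q - 1)) mod Q"
  have "[k * (B + 1) = k * (x + (Q - 1) + 1)] (mod Q)"
    unfolding B_def by (intro cong_mult cong_add cong_refl) (simp_all add: cong_def)
  also have "k * (x + (Q - 1) + 1) = k * x + k * Q"
    using assms(2) by (simp flip: distrib_left)
  also have "[k * x + k * Q = k * x] (mod Q)"
    by (simp add: cong_def)
  also note x
  finally show ?thesis using assms(2) by (intro exI[of _ B]) (auto simp: B_def)
qed

text \<open>With \<open>c_eq_quotient\<close> this makes \<open>c n k\<close> an integer.
  Multiplicities are compared at each prime \<open>q\<close>: if \<open>q\<close> divides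
  \<open>k\<close>, the power \<open>k ^ n\<close> alone suffices; otherwise the product
  does.\<close>

lemma fact_dvd_power_mult_prod:
  fixes k n :: nat
  assumes k: "k > 0"
  shows "fact n dvd k ^ n * (\<Prod>i<n. 1 + i * k)"
proof (rule multiplicity_le_imp_dvd)
  fix q :: nat
  assume q: "prime q"
  \<comment> \<open>One cutoff for both products; inserting 0 keeps the set nonempty when
    \<open>n = 0\<close>.\<close>
  define T where "T = Max (insert 0 ((\<lambda>i. multiplicity q (1 + i)) ` {..<n} \<union> (\<lambda>i. multiplicity q (1 + i * k)) ` {..<n}))"
  have T1: "multiplicity q (1 + i) \<le> T" and T2: "multiplicity q (1 + i * k) \<le> T" if "i < n" for i
    unfolding T_def using that by (auto intro!: Max_ge)
  have fact: "multiplicity q (fact n) = (\<Sum>M=1..T. n div q ^ M)"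
    using T1 by (intro multiplicity_fact_eq_sum_div q)
  have mult: "multiplicity q (k ^ n * (\<Prod>i<n. 1 + i * k))
      = n * multiplicity q k + multiplicity q (\<Prod>i<n. 1 + i * k)"
    using q k by (subst prime_elem_multiplicity_mult_distrib)
      (auto simp: prime_elem_multiplicity_power_distrib)
  show "multiplicity q (fact n) \<le> multiplicity q (k ^ n * (\<Prod>i<n. 1 + i * k))"
  proof (cases "q dvd k")
    case True
    then have "multiplicity q k \<ge> 1"
      using q k by (intro multiplicity_geI) auto
    then have "n \<le> n * multiplicity q k" by simp
    moreover have "multiplicity q (fact n) \<le> n"
      unfolding fact using prime_ge_2_nat[OF q] by (rule sum_div_powers_le)
    ultimately show ?thesis unfolding mult by linarith
  next
    case False
    have "n div q ^ M \<le> card {i\<in>{..<n}. q ^ M dvd 1 + i * k}" for M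
    proof -
      have "coprime k (q ^ M)"
        using prime_imp_coprime[OF q False] by (simp add: coprime_commute)
      then obtain B where "B < q ^ M" "[k * (B + 1) = 1] (mod q ^ M)"
        using exists_shifted_inverse[of k "q ^ M"] q prime_gt_0_nat by auto
      from card_dvd_linear[OF this, of n] show ?thesis
        by (simp add: div_le_mono)
    qed
    then have "(\<Sum>M=1..T. n div q ^ M) \<le> (\<Sum>M=1..T. card {i\<in>{..<n}. q ^ M dvd 1 + i * k})"
      by (rule sum_mono)
    also have "\<dots> = multiplicity q (\<Prod>i<n. 1 + i * k)"
      using T2 by (intro multiplicity_prod_eq_sum_card[symmetric] q) auto
    finally show ?thesis unfolding fact mult by linarith
  qed
qed auto

text \<open>The substitution multiplies the binomial coefficient by \<open>(- (k^2))^n\<close>.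
  Giving one \<open>- (k^2)\<close> to each factor \<open>- 1 / k - i\<close> turns it into
  \<open>k * (1 + i * k)\<close>.\<close>

lemma c_eq_quotient:
  assumes "k > 0"
  shows "c n k = of_nat (k ^ n * (\<Prod>i<n. 1 + i * k)) / fact n"
proof -
  have "c n k = (- (of_nat k ^ 2)) ^ n * ((- 1 / of_nat k) gchoose n)"
    unfolding c_def gen_binomial_fps_def
    using fps_compose_linear[of "fps_binomial (- 1 / of_nat k)" "- (of_nat k ^ 2) :: rat"]
    \<comment> \<open>Reversing \<open>fps_const_neg\<close> moves the minus sign out of the
      constant, as in \<open>gen_binomial_fps\<close>.\<close>
    by (simp add: fps_const_neg[symmetric] del: fps_const_neg)
  also have "\<dots> = (- (of_nat k ^ 2)) ^ n * (\<Prod>i<n. - 1 / of_nat k - of_nat i) / fact n"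
    by (simp add: gbinomial_prod_rev atLeast0LessThan)
  also have "(- (of_nat k ^ 2)) ^ n * (\<Prod>i<n. - 1 / of_nat k - of_nat i)
      = (\<Prod>i<n. - (of_nat k ^ 2) * (- 1 / of_nat k - of_nat i) :: rat)"
    by (subst prod.distrib) simp
  also have "\<dots> = (\<Prod>i<n. of_nat k * of_nat (1 + i * k))"
    using assms by (intro prod.cong) (auto simp: field_simps power2_eq_square)
  also have "\<dots> = of_nat (k ^ n * (\<Prod>i<n. 1 + i * k))"
    by (simp add: prod.distrib)
  finally show ?thesis .
qed

section \<open>Valuations of integers and rationals\<close>

lemma multiplicity_int_int:
  fixes p n :: nat
  assumes "prime p" "n > 0"
  shows "multiplicity (int p) (int n) = multiplicity p n"
proof -
  obtain m where m: "n = p ^ multiplicity p n * m" "\<not> p dvd m"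
    using assms not_prime_unit by (metis multiplicity_decompose' less_not_refl2)
  have "int n = int p ^ multiplicity p n * int m"
    by (subst m(1)) simp
  then show ?thesis
    using assms m(2) by (intro multiplicity_eqI) auto
qed

text \<open>In lowest terms \<open>u / v\<close>, coprimality forces \<open>v\<close> to divide
  \<open>k\<close>, so \<open>p\<close> divides neither \<open>v\<close> nor \<open>k\<close>.
  Comparing multiplicities in \<open>z * v = u * k\<close> then shows that \<open>u\<close> and
  \<open>z\<close> have the same one.\<close>

lemma padic_val_divide:
  fixes p k :: nat and z :: int
  assumes p: "prime p" and k: "\<not> p dvd k" and z: "z \<noteq> 0"
  shows "padic_val p (of_int z / of_nat k) = int (multiplicity (int p) z)"
proof -
  obtain u v where uv: "quotient_of (of_int z / of_nat k) = (u, v)" by fastforce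
  have k0: "k > 0" using k by (intro Nat.gr0I) auto
  have v: "v > 0" using quotient_of_denom_pos[OF uv] .
  have cop: "coprime u v" using quotient_of_coprime[OF uv] .
  have "(of_int z / of_nat k :: rat) = of_int u / of_int v" using quotient_of_div[OF uv] .
  then have "(of_int (z * v) :: rat) = of_int (u * int k)"
    using k0 v by (simp add: field_simps)
  then have eq: "z * v = u * int k" by (simp only: of_int_eq_iff)
  then have "v dvd int k" using cop
    by (metis coprime_commute coprime_dvd_mult_right_iff dvd_triv_right)
  moreover have pk: "\<not> int p dvd int k" using k by simp
  ultimately have pv: "\<not> int p dvd v" using dvd_trans by blast
  have pp: "prime_elem (int p)" using p by simp
  have "u \<noteq> 0" using eq z v by auto
  have "multiplicity (int p) (z * v) = multiplicity (int p) z"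
    using pp pv z v by (simp add: prime_elem_multiplicity_mult_distrib not_dvd_imp_multiplicity_0)
  moreover have "multiplicity (int p) (u * int k) = multiplicity (int p) u"
    using pp pk \<open>u \<noteq> 0\<close> k0 by (simp add: prime_elem_multiplicity_mult_distrib not_dvd_imp_multiplicity_0)
  ultimately show ?thesis
    unfolding padic_val_def uv using eq pv by (simp add: not_dvd_imp_multiplicity_0)
qed

section \<open>Truncated digit expansions\<close>

definition digit_sum :: "nat \<Rightarrow> (nat \<Rightarrow> nat) \<Rightarrow> nat \<Rightarrow> nat" where
  "digit_sum p b M = (\<Sum>i<M. b i * p ^ i)"

lemma digit_sum_0 [simp]: "digit_sum p b 0 = 0"
  by (simp add: digit_sum_def)

lemma digit_sum_Suc: "digit_sum p b (Suc M) = digit_sum p b M + b M * p ^ M"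
  by (simp add: digit_sum_def)

lemma digit_sum_less:
  assumes "p > 0" and "\<And>m. b m \<le> p - 1"
  shows "digit_sum p b M < p ^ M"
proof (induction M)
  case (Suc M)
  have "b M * p ^ M \<le> (p - 1) * p ^ M" using assms(2) by simp
  then have "digit_sum p b (Suc M) < p ^ M + (p - 1) * p ^ M"
    unfolding digit_sum_Suc using Suc by linarith
  also have "\<dots> = p ^ Suc M" using assms(1) by (simp add: algebra_simps)
  finally show ?case .
qed simp

lemma digit_sum_cong:
  assumes "M \<le> N"
  shows "[digit_sum p b N = digit_sum p b M] (mod p ^ M)"
  using assms
proof (induction N rule: dec_induct)
  case (step N)
  have "p ^ M dvd b N * p ^ N" using step by (simp add: le_imp_power_dvd)
  then have "[digit_sum p b N + b N * p ^ N = digit_sum p b N + 0] (mod p ^ M)"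
    by (intro cong_add cong_refl) (simp add: cong_0_iff)
  then show ?case using step cong_trans by (auto simp: digit_sum_Suc)
qed simp

text \<open>A late partial sum is p-adically close to \<open>1 / k - 1\<close>. Clearing the
  denominator \<open>k\<close>, a p-adic unit, turns closeness into a congruence, which descends to
  the truncation at \<open>M\<close>.\<close>

lemma digit_sum_inverse:
  fixes p k :: nat
  assumes p: "prime p" and k: "\<not> p dvd k" and b: "padic_digits p b (1 / of_nat k - 1)"
  shows "[k * (digit_sum p b M + 1) = 1] (mod p ^ M)"
proof -
  have k0: "k > 0" using k by (intro Nat.gr0I) auto
  have p1: "real p > 1" using prime_gt_1_nat[OF p] by simp
  have "(\<lambda>N. padic_abs p ((\<Sum>m<N. of_nat (b m) * of_nat p ^ m) - (1 / of_nat k - 1))) \<longlonglongrightarrow> 0"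
    using b by (simp add: padic_digits_def padic_sums_def)
  then have "eventually (\<lambda>N. padic_abs p ((\<Sum>m<N. of_nat (b m) * of_nat p ^ m) - (1 / of_nat k - 1))
      < real p powi (- int M)) sequentially"
    using p1 by (intro order_tendstoD) auto
  then obtain N0 where N0: "\<And>N. N \<ge> N0 \<Longrightarrow>
      padic_abs p ((\<Sum>m<N. of_nat (b m) * of_nat p ^ m) - (1 / of_nat k - 1)) < real p powi (- int M)"
    by (auto simp: eventually_sequentially)
  \<comment> \<open>Large enough for the p-adic estimate, and at least \<open>M\<close> so that
    \<open>digit_sum_cong\<close> applies.\<close>
  define N where "N = max N0 M"
  define z where "z = int k * (int (digit_sum p b N) + 1) - 1"
  have "(\<Sum>m<N. of_nat (b m) * of_nat p ^ m) - (1 / of_nat k - 1) = (of_int z / of_nat k :: rat)"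
    using k0 by (simp add: z_def digit_sum_def field_simps)
  then have less: "padic_abs p (of_int z / of_nat k) < real p powi (- int M)"
    using N0[of N] by (simp add: N_def)
  have "int p ^ M dvd z"
  \<comment> \<open>The value 0 is split off because \<open>padic_abs\<close> treats it separately
    and \<open>padic_val_divide\<close> excludes it.\<close>
  proof (cases "z = 0")
    case False
    then have "real p powi (- int (multiplicity (int p) z)) < real p powi (- int M)"
      using less k0 by (simp add: padic_abs_def padic_val_divide[OF p k])
    then have "M \<le> multiplicity (int p) z"
      using p1 by (metis linorder_not_less neg_le_iff_le of_nat_le_iff power_int_increasing less_imp_le)
    then show ?thesis by (simp add: multiplicity_dvd')
  qed simp
  then have "[int k * (int (digit_sum p b N) + 1) = 1] (mod int p ^ M)"
    by (simp add: z_def cong_iff_dvd_diff)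
  then have "[int (k * (digit_sum p b N + 1)) = int 1] (mod int (p ^ M))"
    by (simp add: algebra_simps)
  then have "[k * (digit_sum p b N + 1) = 1] (mod p ^ M)"
    by (simp only: cong_int_iff)
  moreover have "[k * (digit_sum p b N + 1) = k * (digit_sum p b M + 1)] (mod p ^ M)"
    using digit_sum_cong[of M N p b] by (intro cong_mult cong_add cong_refl) (simp add: N_def)
  ultimately show ?thesis using cong_sym cong_trans by blast
qed

text \<open>Truncating beyond the last nonzero digit gives \<open>n\<close> itself; the truncation
  at \<open>M\<close> is congruent to it and, being below \<open>p ^ M\<close>, is the
  remainder.\<close>

lemma digit_sum_eq_mod:
  assumes p: "p > 0" and a: "base_digits p a n"
  shows "digit_sum p a M = n mod p ^ M"
proof -
  have fin: "finite {m. a m \<noteq> 0}" and le: "\<And>m. a m \<le> p - 1"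
    and n: "n = (\<Sum>m | a m \<noteq> 0. a m * p ^ m)"
    using a by (auto simp: base_digits_def)
  obtain L where L: "{m. a m \<noteq> 0} \<subseteq> {..<L}"
    using fin by (meson finite_nat_iff_bounded)
  define N where "N = max L M"
  have "digit_sum p a N = n"
    unfolding n digit_sum_def using L by (intro sum.mono_neutral_right) (auto simp: N_def)
  then have "[n = digit_sum p a M] (mod p ^ M)"
    using digit_sum_cong[of M N p a] by (simp add: N_def)
  then show ?thesis
    using digit_sum_less[of p a M] p le by (simp add: cong_def)
qed

section \<open>Carries and overflow of truncations\<close>

lemma carry_positions_0: "0 \<in> carry_positions p a b \<longleftrightarrow> a 0 + b 0 \<ge> p"
  by (simp add: carry_positions_def)

text \<open>The recursion for carries: a digit sum \<open>p - 1\<close> passes on an incoming carry.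
  A run of length \<open>j + 1\<close> ending at \<open>Suc m\<close> is that digit sum followed by
  a run of length \<open>j\<close> ending at \<open>m\<close>.\<close>

lemma carry_positions_Suc:
  "Suc m \<in> carry_positions p a b \<longleftrightarrow>
     a (Suc m) + b (Suc m) \<ge> p \<or> a (Suc m) + b (Suc m) = p - 1 \<and> m \<in> carry_positions p a b"
proof -
  \<comment> \<open>At \<open>j = 0\<close> this is the first alternative of
    \<open>carry_positions\<close>, so both alternatives merge into one existential.\<close>
  define P where "P m j \<longleftrightarrow>
    (\<forall>i<j. a (m - i) + b (m - i) = p - 1) \<and> a (m - j) + b (m - j) \<ge> p" for m j
  have mem: "m \<in> carry_positions p a b \<longleftrightarrow> (\<exists>j\<le>m. P m j)" for m
    unfolding carry_positions_def P_def by force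
  have P0: "P m 0 \<longleftrightarrow> a m + b m \<ge> p" for m by (simp add: P_def)
  have PS: "P (Suc m) (Suc j) \<longleftrightarrow> a (Suc m) + b (Suc m) = p - 1 \<and> P m j" for j
    by (auto simp: P_def All_less_Suc2)
  have "(\<exists>j\<le>Suc m. P (Suc m) j) \<longleftrightarrow> P (Suc m) 0 \<or> (\<exists>j\<le>m. P (Suc m) (Suc j))"
    by (metis Suc_le_mono not0_implies_Suc zero_le)
  then show ?thesis by (auto simp: mem P0 PS)
qed

lemma carry_positions_iff_digit_sum:
  assumes p: "p > 0" and a: "\<And>m. a m \<le> p - 1" and b: "\<And>m. b m \<le> p - 1"
  shows "m \<in> carry_positions p a b \<longleftrightarrow>
           digit_sum p a (Suc m) + digit_sum p b (Suc m) \<ge> p ^ Suc m"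
proof (induction m)
  case 0
  show ?case by (simp add: carry_positions_0 digit_sum_Suc)
next
  case (Suc m)
  define A where "A = digit_sum p a (Suc m)"
  define B where "B = digit_sum p b (Suc m)"
  define Q where "Q = p ^ Suc m"
  define s where "s = a (Suc m) + b (Suc m)"
  have AB: "A < Q" "B < Q"
    unfolding A_def B_def Q_def using digit_sum_less assms by blast+
  have "digit_sum p a (Suc (Suc m)) + digit_sum p b (Suc (Suc m)) = (A + B) + s * Q"
    unfolding A_def B_def Q_def s_def digit_sum_Suc[of _ _ "Suc m"] by (simp only: algebra_simps)
  moreover have "p ^ Suc (Suc m) = p * Q" by (simp add: Q_def)
  \<comment> \<open>Since \<open>A + B < 2 * Q\<close>, the lower digits carry at most one:
    \<open>s \<le> p - 2\<close> never overflows, and \<open>s = p - 1\<close> does so only with a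
    carry.\<close>
  moreover have "(A + B) + s * Q \<ge> p * Q \<longleftrightarrow> s \<ge> p \<or> s = p - 1 \<and> A + B \<ge> Q"
  proof -
    consider "s \<ge> p" | "s + 1 = p" | "s + 2 \<le> p" by linarith
    then show ?thesis
    proof cases
      case 1
      then have "p * Q \<le> s * Q" by simp
      then show ?thesis using 1 by (simp add: trans_le_add2)
    next
      case 2
      then show ?thesis by (auto simp: algebra_simps)
    next
      case 3
      then have "(s + 2) * Q \<le> p * Q" by (rule mult_le_mono1)
      then have "s * Q + 2 * Q \<le> p * Q" by (simp add: algebra_simps)
      then show ?thesis using 3 AB by linarith
    qed
  qed
  ultimately show ?case
    using Suc unfolding carry_positions_Suc A_def B_def Q_def s_def by simp
qed

section \<open>From carries to the valuation of the coefficient\<close>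

lemma add_div_eq_if:
  fixes n B Q :: nat
  assumes "B < Q"
  shows "(n + B) div Q = n div Q + (if n mod Q + B \<ge> Q then 1 else 0)"
proof -
  have "(n + B) div Q = n div Q + (n mod Q + B) div Q"
    using assms by (subst div_add1_eq) simp
  also have "(n mod Q + B) div Q = (if n mod Q + B \<ge> Q then 1 else 0)"
  proof -
    have "n mod Q + B < Q + Q"
      using assms by (intro add_strict_mono mod_less_divisor) auto
    then show ?thesis by (auto intro!: div_nat_eqI)
  qed
  finally show ?thesis .
qed

theorem theorem3p7:
  fixes k p n :: nat and a b :: "nat \<Rightarrow> nat"
  assumes "k > 0" and "prime p" and "\<not> p dvd k"
    and "base_digits p a n"
    and "padic_digits p b (1 / of_nat k - 1)"
  shows "\<exists>N::int. c n k = of_int N \<and> N \<noteq> 0 \<and> finite (carry_positions p a b) \<and>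
           multiplicity (int p) N = card (carry_positions p a b)"
proof -
  define P where "P = (\<Prod>i<n. 1 + i * k)"
  define C where "C = carry_positions p a b"
  have p0: "p > 0" using assms(2) prime_gt_0_nat by blast
  have a: "\<And>m. a m \<le> p - 1" and b: "\<And>m. b m \<le> p - 1"
    using assms by (auto simp: base_digits_def padic_digits_def)
  obtain N where N: "k ^ n * P = fact n * N"
    using fact_dvd_power_mult_prod[OF assms(1)] unfolding P_def by auto
  have "P > 0" unfolding P_def by (intro prod_pos) simp
  then have N0: "N > 0" using N assms(1) by (intro Nat.gr0I) auto
  have "c n k = of_nat (fact n * N) / fact n"
    unfolding c_eq_quotient[OF assms(1)] using N by (simp add: P_def)
  then have cN: "c n k = of_int (int N)" by simp

  \<comment> \<open>The power of \<open>k\<close> is prime to \<open>p\<close> and drops out; the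
    additive form avoids subtraction of naturals.\<close>
  have mult_N: "multiplicity p (fact n) + multiplicity p N = multiplicity p P"
  proof -
    have "multiplicity p (k ^ n) = 0"
      using assms(2,3) by (intro not_dvd_imp_multiplicity_0) (auto dest: prime_dvd_power)
    then have "multiplicity p (k ^ n * P) = multiplicity p P"
      using assms \<open>P > 0\<close> by (subst prime_elem_multiplicity_mult_distrib) auto
    moreover have "multiplicity p (fact n * N) = multiplicity p (fact n) + multiplicity p N"
      using assms N0 by (intro prime_elem_multiplicity_mult_distrib) auto
    ultimately show ?thesis using N by simp
  qed

  \<comment> \<open>For \<open>Q = p ^ Suc m\<close>, the remainder of \<open>n\<close> and the
    residue \<open>B\<close> are the truncations of \<open>a\<close> and \<open>b\<close>, so the
    excess over \<open>n div Q\<close> is the carry out of position \<open>m\<close>.\<close>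
  have count: "card {i\<in>{..<n}. p ^ Suc m dvd 1 + i * k} =
      n div p ^ Suc m + (if m \<in> C then 1 else 0)" for m
  proof -
    have B: "digit_sum p b (Suc m) < p ^ Suc m" using digit_sum_less p0 b by blast
    show ?thesis
      unfolding card_dvd_linear[OF B digit_sum_inverse[OF assms(2,3,5)]] add_div_eq_if[OF B] C_def
        carry_positions_iff_digit_sum[OF p0 a b] digit_sum_eq_mod[OF p0 assms(4)] ..
  qed

  \<comment> \<open>As \<open>x < p ^ x\<close>, multiplicities are bounded by the numbers
    themselves; this \<open>T\<close> dominates the factors of both products and all carry
    positions.\<close>
  define T where "T = n + n * k + 1"
  have less_power: "x < p ^ x" for x
    using prime_gt_1_nat[OF assms(2)] by (simp add: power_gt_expt)
  have mult_le: "multiplicity p x \<le> x" if "x > 0" for x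
    using multiplicity_dvd[of p x] dvd_imp_le[OF _ that] less_power[of "multiplicity p x"]
    by (meson le_trans less_imp_le)
  have T1: "multiplicity p (1 + i) \<le> T" if "i < n" for i
    using mult_le[of "1 + i"] that by (simp add: T_def)
  have T2: "multiplicity p (1 + i * k) \<le> T" if "i < n" for i
    using mult_le[of "1 + i * k"] mult_le_mono1[OF less_imp_le[OF that], of k] unfolding T_def by linarith
  \<comment> \<open>The digits \<open>b\<close> may be nonzero forever, so finiteness comes from the
    count: a carry at \<open>m\<close> forces some factor \<open>1 + i * k\<close> to be divisible
    by \<open>p ^ Suc m\<close>, which bounds \<open>m\<close>.\<close>
  have C_sub: "C \<subseteq> {..<T}"
  proof
    fix m assume m: "m \<in> C"
    then have "card {i\<in>{..<n}. p ^ Suc m dvd 1 + i * k} > 0" using count[of m] by simp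
    then obtain i where i: "i < n" "p ^ Suc m dvd 1 + i * k"
      by (auto simp: card_gt_0_iff)
    then have "Suc m < 1 + i * k"
      using dvd_imp_le[OF i(2)] less_power[of "Suc m"] by simp
    then show "m \<in> {..<T}"
      using mult_le_mono1[OF less_imp_le[OF i(1)], of k] unfolding T_def lessThan_iff by linarith
  qed
  have "multiplicity p P = (\<Sum>M=1..T. card {i\<in>{..<n}. p ^ M dvd 1 + i * k})"
    unfolding P_def using T2 by (intro multiplicity_prod_eq_sum_card assms(2)) auto
  also have "\<dots> = (\<Sum>m<T. card {i\<in>{..<n}. p ^ Suc m dvd 1 + i * k})"
    by (simp only: One_nat_def sum.atLeast1_atMost_eq)
  also have "\<dots> = (\<Sum>m<T. n div p ^ Suc m) + (\<Sum>m<T. if m \<in> C then 1 else 0)"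
    unfolding count by (rule sum.distrib)
  also have "(\<Sum>m<T. n div p ^ Suc m) = (\<Sum>M=1..T. n div p ^ M)"
    by (simp only: One_nat_def sum.atLeast1_atMost_eq)
  also have "\<dots> = multiplicity p (fact n)"
    using T1 by (intro multiplicity_fact_eq_sum_div[symmetric] assms(2))
  also have "(\<Sum>m<T. if m \<in> C then 1 else 0) = card C"
    using C_sub by (simp add: sum.If_cases Int_absorb1)
  finally have "multiplicity p N = card C" using mult_N by linarith
  then have "multiplicity (int p) (int N) = card C"
    using assms(2) N0 by (simp add: multiplicity_int_int)
  moreover have "finite C" using C_sub finite_subset by blast
  ultimately show ?thesis using cN N0 unfolding C_def by (intro exI[of _ "int N"]) simp
qed

end
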